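(* Let $(\mathcal{T}_n)_{n\ge1}$ be a sequence of size-conditioned simply generated trees of type I, II or III, and let $v_n$ be a uniformly chosen vertex of $\mathcal{T}_n$. Then there exist constants $n_0\ge1$ and $C,c>0$, depending only on the weight sequence, such that \[ \mathbf P\bigl(\partial(\mathcal{T}_n,v_n)\ge k\bigr)\le Ce^{-ck}\qquad\text{for any } n\ge n_0 \text{ (for which }\mathcal{T}_n\text{ is defined) and any } k\ge0. \] Here $n_0,C,c$ may be taken to be constants for which the bound $\mathbf P(\partial_{\mathrm p}(\mathcal{T}_n,v_n)\ge k)\le Ce^{-ck}$ holds for all such $n\ge n_0$ and all $k\ge0$.
   Context: **Simply generated trees.** A weight sequence is a sequence $\mathbf w=(\omega_k)_{k\ge0}$ of non-negative reals with $\omega_0>0$ and $\omega_k>0$ for at least one $k\ge2$. For $n\ge 1$, $\mathcal{T}_n$ is the random rooted plane tree with $n$ vertices such that $\mathbf P(\mathcal{T}_n=T)$ is proportional to $\prod_{v\in T}\omega_{d_T^+(v)}$ for each $n$-vertex rooted plane tree $T$, where $d_T^+(v)$ is the outdegree (number of children) of $v$. Throughout, only those $n$ are considered for which some $n$-vertex tree has positive weight ("$\mathcal{T}_n$ is defined"). The vertex $v_n$ is uniform among the vertices of $\mathcal{T}_n$, conditionally on $\mathcal{T}_n$. **Types.** Let $\Phi(z)=\sum_{k\ge0}\omega_kz^k$ with radius of convergence $R\in[0,\infty]$. Type I: there is a (finite) $\tau\in(0,R]$ with $\Phi(\tau)<\infty$ and $\tau\Phi'(\tau)/\Phi(\tau)=1$.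 Type II: $R>0$, $\Phi(R)<\infty$ and $R\Phi'(R)/\Phi(R)<1$. Type III: $R=0$. **Distances.** A leaf is a vertex with no children. For a vertex $v$ of a finite rooted tree $T$, $\partial(T,v)$ is the minimal graph distance from $v$ to a leaf of $T$. The protection number $\partial_{\mathrm p}(T,v)$ is the minimal graph distance from $v$ to a leaf of the fringe subtree of $T$ at $v$ (the subtree consisting of $v$ and all its descendants). *)

theory Defs
  imports "HOL-Probability.Probability"
begin

datatype plane_tree = Node (children: "plane_tree list")

text \<open>Vertices are addressed by the path of child indices (counted from 0) leading to them
  from the root, whose address is the empty list.\<close>

primrec is_vertex :: "plane_tree \<Rightarrow> nat list \<Rightarrow> bool" where
  "is_vertex T [] \<longleftrightarrow> True"
| "is_vertex T (i # v) \<longleftrightarrow> i < length (children T) \<and> is_vertex (children T ! i) v"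

definition vertices :: "plane_tree \<Rightarrow> nat list set" where
  "vertices T = {v. is_vertex T v}"

text \<open>Only meaningful for \<open>v \<in> vertices T\<close>.\<close>

primrec fringe :: "plane_tree \<Rightarrow> nat list \<Rightarrow> plane_tree" where
  "fringe T [] = T"
| "fringe T (i # v) = fringe (children T ! i) v"

definition outdegree :: "plane_tree \<Rightarrow> nat list \<Rightarrow> nat" where
  "outdegree T v = length (children (fringe T v))"

definition leaves :: "plane_tree \<Rightarrow> nat list set" where
  "leaves T = {v \<in> vertices T. outdegree T v = 0}"

definition adjacency :: "plane_tree \<Rightarrow> (nat list \<times> nat list) set" where
  "adjacency T = {(u, v). u \<in> vertices T \<and> v \<in> vertices T \<and>
     ((\<exists>i. v = u @ [i]) \<or> (\<exists>i. u = v @ [i]))}"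

definition graph_dist :: "plane_tree \<Rightarrow> nat list \<Rightarrow> nat list \<Rightarrow> nat" where
  "graph_dist T u v = (LEAST d. (u, v) \<in> adjacency T ^^ d)"

definition leaf_dist :: "plane_tree \<Rightarrow> nat list \<Rightarrow> nat" where
  "leaf_dist T v = Min (graph_dist T v ` leaves T)"

definition protection_number :: "plane_tree \<Rightarrow> nat list \<Rightarrow> nat" where
  "protection_number T v = leaf_dist (fringe T v) []"

definition weight_sequence :: "(nat \<Rightarrow> real) \<Rightarrow> bool" where
  "weight_sequence w \<longleftrightarrow> (\<forall>k. 0 \<le> w k) \<and> 0 < w 0 \<and> (\<exists>k\<ge>2. 0 < w k)"

text \<open>The generating function and its termwise derivative take values in \<open>[0, \<infinity>]\<close> and are
  defined on all of \<open>[0, \<infinity>]\<close>, so that they may be evaluated at the radius of convergence.\<close>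

definition \<Phi> :: "(nat \<Rightarrow> real) \<Rightarrow> ennreal \<Rightarrow> ennreal" where
  "\<Phi> w z = (\<Sum>k. ennreal (w k) * z ^ k)"

definition \<Phi>' :: "(nat \<Rightarrow> real) \<Rightarrow> ennreal \<Rightarrow> ennreal" where
  "\<Phi>' w z = (\<Sum>k. of_nat (Suc k) * ennreal (w (Suc k)) * z ^ k)"

definition radius :: "(nat \<Rightarrow> real) \<Rightarrow> ennreal" where
  "radius w = e2ennreal (conv_radius w)"

definition type_I :: "(nat \<Rightarrow> real) \<Rightarrow> bool" where
  "type_I w \<longleftrightarrow> (\<exists>\<tau>. 0 < \<tau> \<and> \<tau> < \<infinity> \<and> \<tau> \<le> radius w \<and> \<Phi> w \<tau> < \<infinity> \<and> \<tau> * \<Phi>' w \<tau> / \<Phi> w \<tau> = 1)"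

definition type_II :: "(nat \<Rightarrow> real) \<Rightarrow> bool" where
  "type_II w \<longleftrightarrow> 0 < radius w \<and> \<Phi> w (radius w) < \<infinity> \<and>
     radius w * \<Phi>' w (radius w) / \<Phi> w (radius w) < 1"

definition type_III :: "(nat \<Rightarrow> real) \<Rightarrow> bool" where
  "type_III w \<longleftrightarrow> radius w = 0"

definition trees_of_size :: "nat \<Rightarrow> plane_tree set" where
  "trees_of_size n = {T. card (vertices T) = n}"

definition tree_weight :: "(nat \<Rightarrow> real) \<Rightarrow> plane_tree \<Rightarrow> real" where
  "tree_weight w T = (\<Prod>v\<in>vertices T. w (outdegree T v))"

definition sgt_defined :: "(nat \<Rightarrow> real) \<Rightarrow> nat \<Rightarrow> bool" where
  "sgt_defined w n \<longleftrightarrow> (\<exists>T\<in>trees_of_size n. 0 < tree_weight w T)"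

text \<open>Law of the simply generated tree with \<open>n\<close> vertices. Only meaningful if
  \<open>sgt_defined w n\<close>; see \<open>pmf_sgt\<close> below.\<close>

definition sgt :: "(nat \<Rightarrow> real) \<Rightarrow> nat \<Rightarrow> plane_tree pmf" where
  "sgt w n = embed_pmf (\<lambda>T. if T \<in> trees_of_size n
     then tree_weight w T / (\<Sum>S\<in>trees_of_size n. tree_weight w S) else 0)"

text \<open>Joint law of the tree and a vertex that is, given the tree, uniform.\<close>

definition marked_sgt :: "(nat \<Rightarrow> real) \<Rightarrow> nat \<Rightarrow> (plane_tree \<times> nat list) pmf" where
  "marked_sgt w n = do {
     T \<leftarrow> sgt w n;
     v \<leftarrow> pmf_of_set (vertices T);
     return_pmf (T, v)}"

definition exp_tail :: "(plane_tree \<Rightarrow> nat list \<Rightarrow> nat) \<Rightarrow> (nat \<Rightarrow> real) \<Rightarrow> nat \<Rightarrow> real \<Rightarrow> real \<Rightarrow> bool" where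
  "exp_tail X w n\<^sub>0 C c \<longleftrightarrow> (\<forall>n\<ge>n\<^sub>0. sgt_defined w n \<longrightarrow>
     (\<forall>k. measure_pmf.prob (marked_sgt w n) {(T, v). k \<le> X T v} \<le> C * exp (- c * real k)))"

lemma vertices_Node:
  "vertices (Node ts) = insert [] (\<Union>i<length ts. Cons i ` vertices (ts ! i))"
proof -
  have "v \<in> vertices (Node ts) \<longleftrightarrow> v \<in> insert [] (\<Union>i<length ts. Cons i ` vertices (ts ! i))" for v
    by (cases v) (auto simp: vertices_def)
  then show ?thesis by blast
qed

lemma finite_vertices: "finite (vertices T)"
  by (induction T) (auto simp: vertices_Node)

lemma vertices_nonempty: "vertices T \<noteq> {}"
  by (cases T) (simp add: vertices_Node)

lemma card_vertices_Node:
  "card (vertices (Node ts)) = Suc (\<Sum>i<length ts. card (vertices (ts ! i)))"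
proof -
  have "card (\<Union>i<length ts. Cons i ` vertices (ts ! i)) =
      (\<Sum>i<length ts. card (Cons i ` vertices (ts ! i)))"
    by (rule card_UN_disjoint) (auto simp: finite_vertices)
  also have "\<dots> = (\<Sum>i<length ts. card (vertices (ts ! i)))"
    by (simp add: card_image)
  finally show ?thesis
    unfolding vertices_Node by (subst card_insert_disjoint) (auto simp: finite_vertices)
qed

lemma finite_trees_of_size: "finite (trees_of_size n)"
proof (induction n rule: less_induct)
  case (less n)
  let ?A = "\<Union>m<n. trees_of_size m"
  have "trees_of_size n \<subseteq> Node ` {ts. set ts \<subseteq> ?A \<and> length ts \<le> n}"
  proof
    fix T assume T: "T \<in> trees_of_size n"
    obtain ts where ts: "T = Node ts" by (cases T)
    have n: "n = Suc (\<Sum>i<length ts. card (vertices (ts ! i)))"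
      using T by (simp add: trees_of_size_def ts card_vertices_Node)
    have "card (vertices (ts ! i)) < n" if "i < length ts" for i
    proof -
      have "card (vertices (ts ! i)) \<le> (\<Sum>i<length ts. card (vertices (ts ! i)))"
        using that by (intro member_le_sum) auto
      then show ?thesis using n by simp
    qed
    then have "set ts \<subseteq> ?A" by (auto simp: trees_of_size_def in_set_conv_nth)
    moreover have "(\<Sum>i<length ts. 1) \<le> (\<Sum>i<length ts. card (vertices (ts ! i)))"
      by (intro sum_mono)
        (simp add: Suc_le_eq card_gt_0_iff finite_vertices vertices_nonempty)
    then have "length ts \<le> n" using n by simp
    ultimately show "T \<in> Node ` {ts. set ts \<subseteq> ?A \<and> length ts \<le> n}" by (auto simp: ts)
  qed
  moreover have "finite ?A" using less by auto
  ultimately show ?case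
    by (elim finite_subset) (intro finite_imageI finite_lists_length_le)
qed

lemma pmf_sgt:
  assumes "weight_sequence w" and "sgt_defined w n"
  shows "pmf (sgt w n) T =
    (if T \<in> trees_of_size n then tree_weight w T / (\<Sum>S\<in>trees_of_size n. tree_weight w S) else 0)"
proof -
  let ?Z = "\<Sum>S\<in>trees_of_size n. tree_weight w S"
  let ?p = "\<lambda>T. if T \<in> trees_of_size n then tree_weight w T / ?Z else 0"
  have nonneg: "0 \<le> tree_weight w S" for S
    using assms(1) by (auto simp: tree_weight_def weight_sequence_def intro: prod_nonneg)
  have Z: "0 < ?Z"
    using assms(2) nonneg finite_trees_of_size by (auto simp: sgt_defined_def intro: sum_pos2)
  have p: "0 \<le> ?p S" for S
    using nonneg Z by auto
  have "(\<integral>\<^sup>+S. ennreal (?p S) \<partial>count_space UNIV) = (\<Sum>S\<in>trees_of_size n. ennreal (?p S))"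
    by (intro nn_integral_count_space'[OF finite_trees_of_size]) auto
  also have "\<dots> = ennreal (\<Sum>S\<in>trees_of_size n. ?p S)"
    using p by (intro sum_ennreal)
  also have "(\<Sum>S\<in>trees_of_size n. ?p S) = 1"
    using Z by (simp add: sum_divide_distrib[symmetric])
  finally show ?thesis
    unfolding sgt_def using p by (intro pmf_embed_pmf) auto
qed

end

theory Submission
  imports Defs
begin

text \<open>Only unary vertices can make protection numbers large: in a tree without them, the number of
  vertices with protection number at least \<open>k\<close> at least halves when \<open>k\<close> increases by one.
  Suppressing the unary vertices of a tree leaves its core, and since the weight depends only on the
  core and on the number of unary vertices, the latter are distributed over the core of \<open>\<T>\<^sub>n\<close>
  as a uniform composition. If the core contains a positive fraction of the vertices,
  the lengths of the unary chains have exponential tails that multiply over distinct core vertices;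
  summing along the path from a core vertex to its nearest core leaf, an exponential moment of the
  protection number is bounded. Cores that are too small have exponentially small
  probability: attaching a star to the core at the cost of some unary vertices at least doubles the
  total weight and can be repeated linearly often.\<close>

section \<open>Fringe subtrees and nearest leaves\<close>

lemma is_vertex_append:
  "is_vertex T (v @ u) \<longleftrightarrow> is_vertex T v \<and> is_vertex (fringe T v) u"
  by (induction v arbitrary: T) auto

lemma fringe_append: "fringe T (v @ u) = fringe (fringe T v) u"
  by (induction v arbitrary: T) auto

lemma append_in_vertices_iff:
  "v @ u \<in> vertices T \<longleftrightarrow> v \<in> vertices T \<and> u \<in> vertices (fringe T v)"
  by (simp add: vertices_def is_vertex_append)

lemma append_in_leaves:
  "v \<in> vertices T \<Longrightarrow> u \<in> leaves (fringe T v) \<Longrightarrow> v @ u \<in> leaves T"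
  by (simp add: leaves_def append_in_vertices_iff outdegree_def fringe_append)

lemma adjacency_relpow_down:
  "v @ u \<in> vertices T \<Longrightarrow> (v, v @ u) \<in> adjacency T ^^ length u"
proof (induction u rule: rev_induct)
  case (snoc i u)
  then have "v @ u \<in> vertices T"
    by (metis append_assoc append_in_vertices_iff)
  with snoc show ?case
    by (auto simp: adjacency_def intro!: relpow_Suc_I)
qed simp

lemma adjacency_relpow_fringe:
  assumes "v \<in> vertices T" and "(x, y) \<in> adjacency (fringe T v) ^^ d"
  shows "(v @ x, v @ y) \<in> adjacency T ^^ d"
  using assms(2)
proof (induction d arbitrary: y)
  case (Suc d)
  then obtain z where "(x, z) \<in> adjacency (fringe T v) ^^ d" "(z, y) \<in> adjacency (fringe T v)"
    by auto
  moreover from this(2) have "(v @ z, v @ y) \<in> adjacency T"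
    using assms(1) by (auto simp: adjacency_def append_in_vertices_iff)
  ultimately show ?case using Suc.IH by (auto intro: relpow_Suc_I)
qed simp

text \<open>Length of a shortest descending path from the root to a leaf, in a recursive form suited
  to structural induction; \<open>protection_number_le\<close> ties it to graph distances.\<close>

primrec root_protection :: "plane_tree \<Rightarrow> nat" where
  "root_protection (Node ts) = (if ts = [] then 0 else Suc (Min (set (map root_protection ts))))"

lemma root_protection_attained:
  assumes "ts \<noteq> []"
  obtains i where "i < length ts" "root_protection (Node ts) = Suc (root_protection (ts ! i))"
proof -
  have "Min (set (map root_protection ts)) \<in> set (map root_protection ts)"
    using assms by (intro Min_in) auto
  then obtain i where "i < length ts" "Min (root_protection ` set ts) = root_protection (ts ! i)"
    by (auto simp: in_set_conv_nth)
  then show thesis using assms that by simp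
qed

lemma root_protection_le:
  "i < length ts \<Longrightarrow> root_protection (Node ts) \<le> Suc (root_protection (ts ! i))"
  by (auto intro!: Min_le)

lemma nearest_leaf: "\<exists>u\<in>leaves T. length u = root_protection T"
proof (induction T)
  case (Node ts)
  show ?case
  proof (cases "ts = []")
    case True
    then show ?thesis by (auto simp: leaves_def vertices_def outdegree_def intro!: bexI[of _ "[]"])
  next
    case False
    then obtain i where i: "i < length ts" "root_protection (Node ts) = Suc (root_protection (ts ! i))"
      by (rule root_protection_attained)
    with Node obtain u where "u \<in> leaves (ts ! i)" "length u = root_protection (ts ! i)"
      by (meson nth_mem)
    with i show ?thesis
      by (intro bexI[of _ "i # u"]) (auto simp: leaves_def vertices_def outdegree_def)
  qed
qed

lemma finite_leaves: "finite (leaves T)"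
  by (auto simp: leaves_def finite_vertices)

lemma protection_number_le: "protection_number T v \<le> root_protection (fringe T v)"
proof -
  let ?F = "fringe T v"
  obtain u where u: "u \<in> leaves ?F" "length u = root_protection ?F"
    using nearest_leaf by blast
  have "protection_number T v \<le> graph_dist ?F [] u"
    using u by (auto simp: protection_number_def leaf_dist_def finite_leaves intro!: Min_le)
  also have "\<dots> \<le> length u"
    using adjacency_relpow_down[of "[]" u ?F] u
    by (auto simp: graph_dist_def leaves_def intro!: Least_le)
  finally show ?thesis using u by simp
qed

text \<open>Leaves of the fringe subtree are leaves of \<open>T\<close>, and paths inside the fringe
  subtree are paths in \<open>T\<close>. So the minimum on the left runs over more leaves, at
  distances that are no larger.\<close>

lemma leaf_dist_le_protection_number:
  assumes "v \<in> vertices T"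
  shows "leaf_dist T v \<le> protection_number T v"
proof -
  let ?F = "fringe T v"
  have "Min (graph_dist ?F [] ` leaves ?F) \<in> graph_dist ?F [] ` leaves ?F"
    using nearest_leaf[of ?F] by (intro Min_in) (auto simp: finite_leaves)
  then obtain u where u: "u \<in> leaves ?F" "protection_number T v = graph_dist ?F [] u"
    by (auto simp: protection_number_def leaf_dist_def)
  \<comment> \<open>\<open>LEAST\<close> attains its value only if some path exists; the descending
    one does.\<close>
  have "([], u) \<in> adjacency ?F ^^ length u"
    using adjacency_relpow_down[of "[]" u ?F] u by (auto simp: leaves_def)
  then have "([], u) \<in> adjacency ?F ^^ graph_dist ?F [] u"
    unfolding graph_dist_def by (rule LeastI)
  from adjacency_relpow_fringe[OF assms this]
  have "graph_dist T v (v @ u) \<le> graph_dist ?F [] u"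
    unfolding graph_dist_def[of T] by (auto intro: Least_le)
  moreover have "leaf_dist T v \<le> graph_dist T v (v @ u)"
    using append_in_leaves[OF assms u(1)] by (auto simp: leaf_dist_def finite_leaves intro!: Min_le)
  ultimately show ?thesis using u by simp
qed

section \<open>Sums and products over the vertices of a tree\<close>

lemma sum_vertices_Node:
  fixes f :: "nat list \<Rightarrow> 'a::comm_monoid_add"
  shows "(\<Sum>v\<in>vertices (Node ts). f v) = f [] + (\<Sum>i<length ts. \<Sum>v\<in>vertices (ts ! i). f (i # v))"
proof -
  have "(\<Sum>v\<in>(\<Union>i<length ts. Cons i ` vertices (ts ! i)). f v)
      = (\<Sum>i<length ts. \<Sum>v\<in>Cons i ` vertices (ts ! i). f v)"
    by (rule sum.UNION_disjoint) (auto simp: finite_vertices)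
  also have "\<dots> = (\<Sum>i<length ts. \<Sum>v\<in>vertices (ts ! i). f (i # v))"
    by (simp add: sum.reindex)
  finally show ?thesis
    unfolding vertices_Node by (subst sum.insert) (auto simp: finite_vertices)
qed

lemma prod_vertices_Node:
  fixes f :: "nat list \<Rightarrow> 'a::comm_monoid_mult"
  shows "(\<Prod>v\<in>vertices (Node ts). f v) = f [] * (\<Prod>i<length ts. \<Prod>v\<in>vertices (ts ! i). f (i # v))"
proof -
  have "(\<Prod>v\<in>(\<Union>i<length ts. Cons i ` vertices (ts ! i)). f v)
      = (\<Prod>i<length ts. \<Prod>v\<in>Cons i ` vertices (ts ! i). f v)"
    by (rule prod.UNION_disjoint) (auto simp: finite_vertices)
  also have "\<dots> = (\<Prod>i<length ts. \<Prod>v\<in>vertices (ts ! i). f (i # v))"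
    by (simp add: prod.reindex)
  finally show ?thesis
    unfolding vertices_Node by (subst prod.insert) (auto simp: finite_vertices)
qed

lemma tree_weight_Node:
  "tree_weight w (Node ts) = w (length ts) * (\<Prod>i<length ts. tree_weight w (ts ! i))"
  unfolding tree_weight_def prod_vertices_Node by (simp add: outdegree_def)

lemma tree_weight_nonneg: "weight_sequence w \<Longrightarrow> 0 \<le> tree_weight w T"
  by (auto simp: tree_weight_def weight_sequence_def intro: prod_nonneg)

section \<open>Cores and unary vertices\<close>

text \<open>\<open>expand T l\<close> stacks \<open>l v\<close> unary vertices on top of each vertex \<open>v\<close> of the core \<open>T\<close>.\<close>

primrec expand :: "plane_tree \<Rightarrow> (nat list \<Rightarrow> nat) \<Rightarrow> plane_tree" where
  "expand (Node ts) = (\<lambda>l. ((\<lambda>T. Node [T]) ^^ l [])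
     (Node (map2 (\<lambda>i e. e (\<lambda>v. l (i # v))) [0..<length ts] (map expand ts))))"

text \<open>In the primitive recursion the recursive results are functions of the labelling, which
  forces the \<open>map2\<close>. This form speaks of the expanded subtrees directly.\<close>

lemma expand_Node:
  "expand (Node ts) l = ((\<lambda>T. Node [T]) ^^ l [])
     (Node (map (\<lambda>i. expand (ts ! i) (\<lambda>v. l (i # v))) [0..<length ts]))"
proof -
  have "map2 (\<lambda>i e. e (\<lambda>v. l (i # v))) [0..<length ts] (map expand ts)
      = map (\<lambda>i. expand (ts ! i) (\<lambda>v. l (i # v))) [0..<length ts]"
    by (rule nth_equalityI) auto
  then show ?thesis by simp
qed

declare expand.simps [simp del]

primrec branching :: "plane_tree \<Rightarrow> bool" where
  "branching (Node ts) \<longleftrightarrow> length ts \<noteq> 1 \<and> list_all branching ts"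

lemma branching_Node: "branching (Node ts) \<longleftrightarrow> length ts \<noteq> 1 \<and> (\<forall>i<length ts. branching (ts ! i))"
  by (simp add: list_all_length)

declare branching.simps [simp del]

lemma card_vertices_unary: "card (vertices (((\<lambda>T. Node [T]) ^^ a) T)) = a + card (vertices T)"
  by (induction a) (auto simp: card_vertices_Node)

lemma tree_weight_unary: "tree_weight w (((\<lambda>T. Node [T]) ^^ a) T) = w 1 ^ a * tree_weight w T"
  by (induction a) (auto simp: tree_weight_Node)

lemma root_protection_unary:
  "root_protection (((\<lambda>T. Node [T]) ^^ a) T) = a + root_protection T"
  by (induction a) auto

lemma card_vertices_expand: "card (vertices (expand T l)) = card (vertices T) + sum l (vertices T)"
  by (induction T arbitrary: l)
    (simp add: expand_Node card_vertices_unary card_vertices_Node sum_vertices_Node sum.distrib)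

text \<open>The labelling enters only through its total. Hence, given the core and the size, all
  placements of the unary vertices are equally likely.\<close>

lemma tree_weight_expand: "tree_weight w (expand T l) = w 1 ^ sum l (vertices T) * tree_weight w T"
proof (induction T arbitrary: l)
  case (Node ts)
  have "(\<Prod>i<length ts. tree_weight w (expand (ts ! i) (\<lambda>v. l (i # v))))
      = (\<Prod>i<length ts. w 1 ^ (\<Sum>v\<in>vertices (ts ! i). l (i # v)) * tree_weight w (ts ! i))"
    using Node by (intro prod.cong) auto
  also have "\<dots> = w 1 ^ (\<Sum>i<length ts. \<Sum>v\<in>vertices (ts ! i). l (i # v)) * (\<Prod>i<length ts. tree_weight w (ts ! i))"
    by (simp only: prod.distrib power_sum)
  finally show ?case
    by (simp add: expand_Node tree_weight_unary tree_weight_Node sum_vertices_Node power_add)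
qed

text \<open>The chain ends at the first vertex that is not unary, so its length can be read off the
  tree.\<close>

lemma unary_eq_iff:
  assumes "length xs \<noteq> 1" "length ys \<noteq> 1"
  shows "((\<lambda>T. Node [T]) ^^ a) (Node xs) = ((\<lambda>T. Node [T]) ^^ b) (Node ys) \<longleftrightarrow> a = b \<and> xs = ys"
  using assms
proof (induction a arbitrary: b)
  case 0
  then show ?case by (cases b) auto
next
  case (Suc a)
  show ?case
  proof (cases b)
    case 0
    then show ?thesis using Suc.prems by auto
  next
    case b: (Suc b')
    show ?thesis using Suc.IH[OF Suc.prems, of b'] by (simp add: b)
  qed
qed

text \<open>The chain at the top determines the label of the root; the children follow by induction.
  Labels off the core are never read by \<open>expand\<close>, so they are fixed to be 0.\<close>

lemma expand_inject:
  assumes "branching T" "branching S" "expand T l = expand S m"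
    and "\<forall>v. v \<notin> vertices T \<longrightarrow> l v = 0" "\<forall>v. v \<notin> vertices S \<longrightarrow> m v = 0"
  shows "T = S \<and> l = m"
  using assms
proof (induction T arbitrary: S l m)
  case (Node ts)
  obtain ss where S: "S = Node ss" by (cases S)
  let ?l = "\<lambda>i v. l (i # v)" and ?m = "\<lambda>i v. m (i # v)"
  have "length ts \<noteq> 1" "length ss \<noteq> 1"
    using Node.prems by (auto simp: S branching_Node)
  then have "l [] = m [] \<and>
      map (\<lambda>i. expand (ts ! i) (?l i)) [0..<length ts] = map (\<lambda>i. expand (ss ! i) (?m i)) [0..<length ss]"
    using Node.prems(3) unfolding S expand_Node by (intro unary_eq_iff[THEN iffD1]) simp_all
  then have root: "l [] = m []"
    and maps: "map (\<lambda>i. expand (ts ! i) (?l i)) [0..<length ts] = map (\<lambda>i. expand (ss ! i) (?m i)) [0..<length ss]"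
    by blast+
  have len: "length ts = length ss"
    using arg_cong[OF maps, of length] by simp
  have eq: "expand (ts ! i) (?l i) = expand (ss ! i) (?m i)" if "i < length ts" for i
    using arg_cong[OF maps, of "\<lambda>xs. xs ! i"] that len by simp
  have sub: "ts ! i = ss ! i \<and> ?l i = ?m i" if i: "i < length ts" for i
  proof (rule Node.IH)
    show "\<forall>v. v \<notin> vertices (ts ! i) \<longrightarrow> ?l i v = 0" "\<forall>v. v \<notin> vertices (ss ! i) \<longrightarrow> ?m i v = 0"
      using Node.prems(4,5) i len by (auto simp: S vertices_def)
  qed (use Node.prems(1,2) i len eq in \<open>auto simp: S branching_Node\<close>)
  have "l v = m v" for v
  proof (cases v)
    case (Cons i u)
    show ?thesis
    proof (cases "i < length ts")
      case True
      from sub[OF this] have "?l i u = ?m i u" by metis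
      then show ?thesis by (simp only: Cons)
    next
      case False
      then show ?thesis using Node.prems(4,5) len by (simp add: Cons S vertices_def)
    qed
  qed (simp add: root)
  moreover have "ts = ss" using len sub by (auto intro: nth_equalityI)
  ultimately show ?case by (auto simp: S)
qed

lemma expand_surj: "\<exists>S l. branching S \<and> (\<forall>v. v \<notin> vertices S \<longrightarrow> l v = 0) \<and> T = expand S l"
proof (induction T)
  case (Node ts)
  show ?case
  proof (cases "length ts = 1")
    case True
    then obtain t where t: "ts = [t]" by (auto simp: length_Suc_conv)
    with Node obtain S l where S: "branching S" "\<forall>v. v \<notin> vertices S \<longrightarrow> l v = 0" "t = expand S l"
      by auto
    obtain ss where ss: "S = Node ss" by (cases S)
    \<comment> \<open>A unary root lengthens the chain above the root of the core of its only
      subtree.\<close>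
    let ?l = "l([] := Suc (l []))"
    have "Node ts = expand S ?l" by (simp add: t S(3) ss expand_Node)
    moreover have "\<forall>v. v \<notin> vertices S \<longrightarrow> ?l v = 0" using S(2) by (auto simp: vertices_def)
    ultimately show ?thesis using S(1) by blast
  next
    case False
    have "\<forall>i<length ts. \<exists>S l. branching S \<and> (\<forall>v. v \<notin> vertices S \<longrightarrow> l v = 0) \<and> ts ! i = expand S l"
      using Node by simp
    then obtain S l where S: "\<And>i. i < length ts \<Longrightarrow> branching (S i)"
      "\<And>i v. i < length ts \<Longrightarrow> v \<notin> vertices (S i) \<Longrightarrow> l i v = 0"
      "\<And>i. i < length ts \<Longrightarrow> ts ! i = expand (S i) (l i)"
      by metis
    let ?S = "Node (map S [0..<length ts])"
    \<comment> \<open>A root that is not unary belongs to the core itself and has no chain above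
      it.\<close>
    let ?l = "\<lambda>v. case v of [] \<Rightarrow> 0 | i # u \<Rightarrow> if i < length ts then l i u else 0"
    have "branching ?S" using False S(1) by (simp add: branching_Node)
    moreover have "\<forall>v. v \<notin> vertices ?S \<longrightarrow> ?l v = 0"
      using S(2) by (auto simp: vertices_def split: list.splits)
    moreover have "Node ts = expand ?S ?l"
      unfolding expand_Node by (auto simp: S(3)[symmetric] intro!: nth_equalityI)
    ultimately show ?thesis by blast
  qed
qed

section \<open>Protection numbers under expansion\<close>

text \<open>\<open>P\<close> consists of the vertices on a path from the root to a nearest leaf of
  the core, both ends included. In the expansion this path still leads to a leaf and is lengthened
  by the chains above its vertices. It is essential that \<open>P\<close> does not depend on
  \<open>l\<close>, which is to be random.\<close>

lemma expand_root_protection_path: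
  "\<exists>P\<subseteq>vertices T. card P = Suc (root_protection T) \<and>
     (\<forall>l. root_protection (expand T l) \<le> root_protection T + sum l P)"
proof (induction T)
  case (Node ts)
  show ?case
  proof (cases "ts = []")
    case True
    then show ?thesis
      by (intro exI[of _ "{[]}"]) (auto simp: vertices_def expand_Node root_protection_unary)
  next
    case False
    then obtain i where i: "i < length ts" "root_protection (Node ts) = Suc (root_protection (ts ! i))"
      by (rule root_protection_attained)
    with Node obtain P where P: "P \<subseteq> vertices (ts ! i)" "card P = Suc (root_protection (ts ! i))"
      "\<And>l. root_protection (expand (ts ! i) l) \<le> root_protection (ts ! i) + sum l P"
      by (meson nth_mem)
    have fin: "finite P" using P(1) finite_vertices finite_subset by blast
    have "root_protection (expand (Node ts) l) \<le> root_protection (Node ts) + sum l (insert [] (Cons i ` P))" for l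
    proof -
      have "root_protection (expand (Node ts) l) \<le> l [] + Suc (root_protection (expand (ts ! i) (\<lambda>v. l (i # v))))"
        unfolding expand_Node root_protection_unary
        using i root_protection_le[of i "map (\<lambda>i. expand (ts ! i) (\<lambda>v. l (i # v))) [0..<length ts]"] by simp
      also have "\<dots> \<le> l [] + Suc (root_protection (ts ! i) + (\<Sum>v\<in>P. l (i # v)))"
        using P(3) by simp
      also have "\<dots> = root_protection (Node ts) + sum l (insert [] (Cons i ` P))"
        using fin i by (subst sum.insert) (auto simp: sum.reindex)
      finally show ?thesis .
    qed
    moreover have "insert [] (Cons i ` P) \<subseteq> vertices (Node ts)"
      using P i by (auto simp: vertices_def)
    moreover have "card (insert [] (Cons i ` P)) = Suc (root_protection (Node ts))"
      using fin P i by (subst card_insert_disjoint) (auto simp: card_image)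
    ultimately show ?thesis by blast
  qed
qed

lemma root_protection_fringe_less:
  assumes "v \<in> vertices T"
  shows "root_protection (fringe T v) < card (vertices T)"
proof -
  obtain P where P: "P \<subseteq> vertices (fringe T v)" "card P = Suc (root_protection (fringe T v))"
    using expand_root_protection_path by blast
  have "card P = card ((@) v ` P)" by (simp add: card_image inj_on_def)
  also have "\<dots> \<le> card (vertices T)"
    using P assms by (intro card_mono) (auto simp: finite_vertices append_in_vertices_iff)
  finally show ?thesis using P by simp
qed

text \<open>A non-leaf core vertex has at least two children of protection number at least one less,
  so protection numbers in a core have tails of order \<open>2 ^ (-k)\<close>. The subtracted term is the
  potential that makes the induction work.\<close>

lemma branching_sum_root_protection:
  assumes "branching T"
  shows "(\<Sum>v\<in>vertices T. (3/2 :: real) ^ root_protection (fringe T v))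
    \<le> 4 * card (vertices T) - 3 * (3/2) ^ root_protection T"
  using assms
proof (induction T)
  case (Node ts)
  let ?p = root_protection and ?x = "3/2 :: real"
  show ?case
  proof (cases "ts = []")
    case True
    then show ?thesis by (simp add: vertices_Node)
  next
    case False
    then obtain j where j: "?p (Node ts) = Suc (?p (ts ! j))" by (rule root_protection_attained)
    have len: "2 \<le> length ts"
      using False Node.prems by (cases ts rule: remdups_adj.cases) (auto simp: branching_Node)
    have "(\<Sum>i<length ts. \<Sum>v\<in>vertices (ts ! i). ?x ^ ?p (fringe (ts ! i) v))
        \<le> (\<Sum>i<length ts. 4 * card (vertices (ts ! i)) - 3 * ?x ^ ?p (ts ! i))"
    proof (intro sum_mono)
      fix i assume "i \<in> {..<length ts}"
      then show "(\<Sum>v\<in>vertices (ts ! i). ?x ^ ?p (fringe (ts ! i) v))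
          \<le> 4 * card (vertices (ts ! i)) - 3 * ?x ^ ?p (ts ! i)"
        using Node.prems by (intro Node.IH) (auto simp: branching_Node)
    qed
    \<comment> \<open>Every child has protection number at least that of \<open>ts ! j\<close>, the
      minimal one.\<close>
    also have "\<dots> \<le> (\<Sum>i<length ts. 4 * card (vertices (ts ! i)) - 3 * ?x ^ ?p (ts ! j))"
    proof (intro sum_mono diff_mono mult_left_mono power_increasing)
      fix i assume "i \<in> {..<length ts}"
      then show "?p (ts ! j) \<le> ?p (ts ! i)" using root_protection_le[of i ts] j by simp
    qed auto
    also have "\<dots> = 4 * (\<Sum>i<length ts. real (card (vertices (ts ! i)))) - length ts * (3 * ?x ^ ?p (ts ! j))"
      by (simp add: sum_subtractf sum_distrib_left)
    also have "\<dots> \<le> 4 * (\<Sum>i<length ts. real (card (vertices (ts ! i)))) - 2 * (3 * ?x ^ ?p (ts ! j))"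
      using len by (intro diff_left_mono mult_right_mono) auto
    \<comment> \<open>Let \<open>y\<close> be the power at \<open>ts ! j\<close>. Two children
      release \<open>6 * y\<close> and the root costs \<open>3/2 * y\<close>; the remaining
      \<open>9/2 * y\<close> is exactly the potential of the root.\<close>
    finally show ?thesis
      using j by (simp add: sum_vertices_Node card_vertices_Node)
  qed
qed

lemma sum_unary:
  fixes f :: "plane_tree \<Rightarrow> real"
  shows "(\<Sum>v\<in>vertices (((\<lambda>T. Node [T]) ^^ a) T). f (fringe (((\<lambda>T. Node [T]) ^^ a) T) v))
    = (\<Sum>v\<in>vertices T. f (fringe T v)) + (\<Sum>i=1..a. f (((\<lambda>T. Node [T]) ^^ i) T))"
  by (induction a) (auto simp: sum_vertices_Node)

text \<open>Along the chain above a core vertex the protection numbers increase by one at each step.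
  The powers of \<open>q\<close> form a geometric sum, dominated by \<open>q / (q - 1)\<close> times
  the term at the top of the chain, so only chain tops remain on the right.\<close>

lemma sum_root_protection_expand:
  fixes q :: real
  assumes "1 < q"
  shows "(\<Sum>v\<in>vertices (expand T l). q ^ root_protection (fringe (expand T l) v))
    \<le> q / (q - 1) * (\<Sum>v\<in>vertices T. q ^ root_protection (expand (fringe T v) (\<lambda>x. l (v @ x))))"
proof (induction T arbitrary: l)
  case (Node ts)
  let ?p = root_protection and ?c = "q / (q - 1)"
  let ?S = "Node (map (\<lambda>i. expand (ts ! i) (\<lambda>v. l (i # v))) [0..<length ts])"
  let ?s = "\<Sum>i<length ts. \<Sum>v\<in>vertices (ts ! i). q ^ ?p (expand (fringe (ts ! i) v) (\<lambda>x. l (i # v @ x)))"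
  \<comment> \<open>The induction closes because \<open>?c + q = ?c * q\<close>.\<close>
  have geo: "q ^ b + (\<Sum>i=1..a. q ^ (i + b)) \<le> ?c * q ^ (a + b)" for a b
  proof (induction a)
    case 0
    show ?case using assms by (simp add: field_simps)
  next
    case (Suc a)
    have "?c * q ^ (a + b) + q ^ (Suc a + b) = ?c * q ^ (Suc a + b)"
      using assms by (simp add: field_simps)
    with Suc show ?case by simp
  qed
  have "(\<Sum>v\<in>vertices (expand (Node ts) l). q ^ ?p (fringe (expand (Node ts) l) v))
      = (\<Sum>v\<in>vertices ?S. q ^ ?p (fringe ?S v)) + (\<Sum>i=1..l []. q ^ (i + ?p ?S))"
    unfolding expand_Node by (subst sum_unary) (simp only: root_protection_unary)
  also have "(\<Sum>v\<in>vertices ?S. q ^ ?p (fringe ?S v))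
      = q ^ ?p ?S + (\<Sum>i<length ts. \<Sum>v\<in>vertices (expand (ts ! i) (\<lambda>v. l (i # v))).
           q ^ ?p (fringe (expand (ts ! i) (\<lambda>v. l (i # v))) v))"
    unfolding sum_vertices_Node by simp
  also have "(\<Sum>i<length ts. \<Sum>v\<in>vertices (expand (ts ! i) (\<lambda>v. l (i # v))).
           q ^ ?p (fringe (expand (ts ! i) (\<lambda>v. l (i # v))) v)) \<le> ?c * ?s"
    unfolding sum_distrib_left[of ?c "\<lambda>i. sum (f i) (A i)" for f A]
  proof (intro sum_mono)
    fix i assume "i \<in> {..<length ts}"
    then show "(\<Sum>v\<in>vertices (expand (ts ! i) (\<lambda>v. l (i # v))).
           q ^ ?p (fringe (expand (ts ! i) (\<lambda>v. l (i # v))) v))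
        \<le> ?c * (\<Sum>v\<in>vertices (ts ! i). q ^ ?p (expand (fringe (ts ! i) v) (\<lambda>x. l (i # v @ x))))"
      by (intro Node.IH) auto
  qed
  also have "q ^ ?p ?S + ?c * ?s + (\<Sum>i=1..l []. q ^ (i + ?p ?S)) \<le> ?c * (q ^ (l [] + ?p ?S) + ?s)"
    using geo[of "?p ?S" "l []"] by (simp only: distrib_left)
  also have "q ^ (l [] + ?p ?S) + ?s
     = (\<Sum>v\<in>vertices (Node ts). q ^ ?p (expand (fringe (Node ts) v) (\<lambda>x. l (v @ x))))"
  proof -
    have "l [] + ?p ?S = ?p (expand (Node ts) l)"
      by (simp only: expand_Node root_protection_unary)
    then show ?thesis by (simp add: sum_vertices_Node)
  qed
  finally show ?case by simp
qed

section \<open>Random compositions\<close>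

text \<open>Weak compositions: parts may be 0. Vanishing outside \<open>A\<close> makes each
  composition a single function, so that the set is finite for finite \<open>A\<close>.\<close>

definition compositions :: "'a set \<Rightarrow> nat \<Rightarrow> ('a \<Rightarrow> nat) set" where
  "compositions A u = {f. (\<forall>x. x \<notin> A \<longrightarrow> f x = 0) \<and> sum f A = u}"

lemma compositions_0: "finite A \<Longrightarrow> compositions A 0 = {\<lambda>_. 0}"
  by (auto simp: compositions_def fun_eq_iff)

lemma compositions_empty: "compositions {} (Suc u) = {}"
  by (auto simp: compositions_def)

text \<open>Either the part at \<open>a\<close> is 0, or one unit can be taken away from it. On
  cardinalities this is Pascal's rule.\<close>

lemma compositions_Suc:
  assumes "finite A" "a \<in> A"
  shows "compositions A (Suc u) =
    compositions (A - {a}) (Suc u) \<union> (\<lambda>f. f(a := Suc (f a))) ` compositions A u"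
proof (intro equalityI subsetI)
  fix f assume f: "f \<in> compositions A (Suc u)"
  show "f \<in> compositions (A - {a}) (Suc u) \<union> (\<lambda>f. f(a := Suc (f a))) ` compositions A u"
  proof (cases "f a")
    case 0
    then show ?thesis using f assms by (auto simp: compositions_def sum.remove)
  next
    case (Suc b)
    have "f(a := b) \<in> compositions A u"
      using f assms Suc by (auto simp: compositions_def sum.remove[of A a])
    then show ?thesis using Suc by (intro UnI2 image_eqI[of _ _ "f(a := b)"]) auto
  qed
next
  fix f assume "f \<in> compositions (A - {a}) (Suc u) \<union> (\<lambda>f. f(a := Suc (f a))) ` compositions A u"
  then show "f \<in> compositions A (Suc u)"
    using assms by (auto simp: compositions_def sum.remove[of A a])
qed

lemma compositions_Suc_disjoint:
  "compositions (A - {a}) (Suc u) \<inter> (\<lambda>f. f(a := Suc (f a))) ` compositions A u = {}"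
  by (auto simp: compositions_def)

lemma inj_on_increment: "inj_on (\<lambda>f. f(a := Suc (f a))) B"
  by (auto simp: inj_on_def fun_eq_iff split: if_splits)

lemma finite_compositions: "finite A \<Longrightarrow> finite (compositions A u)"
proof (induction A arbitrary: u rule: finite_induct)
  case empty
  show ?case by (cases u) (auto simp: compositions_0 compositions_empty)
next
  case (insert a A)
  then show ?case
    by (induction u) (simp_all add: compositions_0 compositions_Suc[of "insert a A" a])
qed

lemma card_compositions_Suc:
  assumes "finite A" "a \<in> A"
  shows "card (compositions A (Suc u)) = card (compositions (A - {a}) (Suc u)) + card (compositions A u)"
  unfolding compositions_Suc[OF assms]
  using assms by (subst card_Un_disjoint)
    (auto simp: finite_compositions compositions_Suc_disjoint card_image inj_on_increment)

lemma card_compositions: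
  "finite A \<Longrightarrow> card A = Suc s \<Longrightarrow> card (compositions A u) = (u + s) choose s"
proof (induction s arbitrary: A u)
  case 0
  then obtain a where A: "A = {a}" by (auto simp: card_Suc_eq)
  show ?case
    by (induction u) (simp_all add: A compositions_0 card_compositions_Suc[of "{a}" a] compositions_empty)
next
  case (Suc s)
  then obtain a where a: "a \<in> A" by fastforce
  with Suc have "card (A - {a}) = Suc s" "finite (A - {a})" by auto
  then have IH: "card (compositions (A - {a}) v) = (v + s) choose s" for v
    using Suc.IH by blast
  show ?case
    by (induction u) (simp_all add: compositions_0 card_compositions_Suc[of A a] Suc.prems a IH)
qed

text \<open>The quotient of the two counts is exactly \<open>Suc u / (Suc u + s)\<close>, and the
  last assumption bounds it by \<open>r\<close>.\<close>

lemma card_compositions_ratio: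
  fixes r :: real
  assumes "finite A" "card A = Suc s" "real (Suc u) \<le> r * real (Suc u + s)"
  shows "card (compositions A u) \<le> r * card (compositions A (Suc u))"
proof -
  have "(u + s choose s) = (u + s choose u)" "(Suc u + s choose s) = (Suc u + s choose Suc u)"
    using binomial_symmetric[of u "u + s"] binomial_symmetric[of "Suc u" "Suc u + s"] by simp_all
  then have "real (Suc u + s) * (u + s choose s) = real (Suc u) * (Suc u + s choose s)"
    using Suc_times_binomial_eq[of "u + s" u] by (metis add_Suc mult.commute of_nat_mult)
  also have "\<dots> \<le> (r * real (Suc u + s)) * (Suc u + s choose s)"
    using assms(3) by (intro mult_right_mono) auto
  also have "\<dots> = real (Suc u + s) * (r * (Suc u + s choose s))" by simp
  finally have "real (u + s choose s) \<le> r * (Suc u + s choose s)"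
    by (subst (asm) mult_le_cancel_left_pos) auto
  then show ?thesis using assms by (simp add: card_compositions)
qed

text \<open>The parts are dominated by independent geometric variables of ratio \<open>r\<close>,
  each contributing a factor \<open>1 / (1 - x * r)\<close>. Parts are added to \<open>S\<close> one
  at a time. For a new part \<open>a\<close>, an induction on \<open>u\<close> splits off the
  compositions with a zero part at \<open>a\<close>; the others carry a factor \<open>x\<close> and
  are counted by the total \<open>u\<close> instead of \<open>Suc u\<close>, which costs a factor
  \<open>r\<close>.\<close>

lemma compositions_exponential_moment:
  fixes r x :: real
  assumes A: "finite A" "card A = Suc s" and x: "1 \<le> x" "0 \<le> r" "x * r < 1"
    and S: "S \<subseteq> A" and u: "real u \<le> r * real (u + s)"
  shows "(\<Sum>f\<in>compositions A u. x ^ sum f S) \<le> (1 / (1 - x * r)) ^ card S * card (compositions A u)"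
proof -
  \<comment> \<open>\<open>M\<close> solves \<open>M = 1 + x * r * M\<close>, the recursion that
    results from this split.\<close>
  define M where "M = 1 / (1 - x * r)"
  have M: "1 + x * r * M = M" using x by (simp add: M_def field_simps)
  have M1: "1 \<le> M" using x by (simp add: M_def field_simps)
  have r1: "r \<le> 1" using x mult_right_mono[of 1 x r] by simp
  have "finite S" using S A finite_subset by blast
  then have "(\<Sum>f\<in>compositions A u. x ^ sum f S) \<le> M ^ card S * card (compositions A u)"
    using S u
  proof (induction S arbitrary: u rule: finite_induct)
    case (insert a S)
    then have a: "a \<in> A" by simp
    show ?case using \<open>real u \<le> r * real (u + s)\<close>
    proof (induction u)
      case 0
      show ?case using A M1 by (simp add: compositions_0 sum.neutral del: power_Suc)
    next
      case (Suc u)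
      let ?C = "compositions A" and ?m = "card S"
      \<comment> \<open>Since \<open>r \<le> 1\<close>, the density condition passes from
        \<open>Suc u\<close> down to \<open>u\<close>.\<close>
      have "real u = real (Suc u) - 1" by simp
      also have "\<dots> \<le> r * real (Suc u + s) - r" using Suc.prems r1 by linarith
      also have "\<dots> = r * real (u + s)" by (simp add: algebra_simps)
      finally have u: "real u \<le> r * real (u + s)" .
      have "(\<Sum>f\<in>compositions (A - {a}) (Suc u). x ^ sum f (insert a S))
          = (\<Sum>f\<in>compositions (A - {a}) (Suc u). x ^ sum f S)"
        using insert.hyps by (intro sum.cong) (auto simp: compositions_def)
      also have "\<dots> \<le> (\<Sum>f\<in>?C (Suc u). x ^ sum f S)"
        using A a x by (intro sum_mono2) (auto simp: finite_compositions compositions_Suc[OF A(1) a])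
      also have "\<dots> \<le> M ^ ?m * card (?C (Suc u))"
        using insert.prems Suc.prems by (intro insert.IH) auto
      finally have 1: "(\<Sum>f\<in>compositions (A - {a}) (Suc u). x ^ sum f (insert a S))
        \<le> M ^ ?m * card (?C (Suc u))" .
      have "(\<Sum>f\<in>(\<lambda>f. f(a := Suc (f a))) ` ?C u. x ^ sum f (insert a S))
          = (\<Sum>f\<in>?C u. x ^ sum (f(a := Suc (f a))) (insert a S))"
        by (subst sum.reindex) (auto simp: inj_on_increment)
      also have "\<dots> = (\<Sum>f\<in>?C u. x * x ^ sum f (insert a S))"
      proof (intro sum.cong refl)
        fix f
        have "sum (f(a := Suc (f a))) S = sum f S"
          using insert.hyps by (intro sum.cong) auto
        then show "x ^ sum (f(a := Suc (f a))) (insert a S) = x * x ^ sum f (insert a S)"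
          using insert.hyps by simp
      qed
      also have "\<dots> \<le> x * (M ^ Suc ?m * card (?C u))"
        unfolding sum_distrib_left[symmetric] using Suc.IH[OF u] x insert.hyps
        by (intro mult_left_mono) auto
      also have "\<dots> \<le> x * (M ^ Suc ?m * (r * card (?C (Suc u))))"
        using x M1 card_compositions_ratio[OF A Suc.prems] by (intro mult_left_mono) auto
      finally have 2: "(\<Sum>f\<in>(\<lambda>f. f(a := Suc (f a))) ` ?C u. x ^ sum f (insert a S))
        \<le> x * (M ^ Suc ?m * (r * card (?C (Suc u))))" .
      have "(\<Sum>f\<in>?C (Suc u). x ^ sum f (insert a S))
          = (\<Sum>f\<in>compositions (A - {a}) (Suc u). x ^ sum f (insert a S))
          + (\<Sum>f\<in>(\<lambda>f. f(a := Suc (f a))) ` ?C u. x ^ sum f (insert a S))"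
        unfolding compositions_Suc[OF A(1) a]
        using A by (intro sum.union_disjoint) (auto simp: finite_compositions compositions_Suc_disjoint)
      also have "\<dots> \<le> M ^ ?m * card (?C (Suc u)) + x * (M ^ Suc ?m * (r * card (?C (Suc u))))"
        using 1 2 by (rule add_mono)
      also have "\<dots> = M ^ ?m * card (?C (Suc u)) * (1 + x * r * M)"
        by (simp add: algebra_simps)
      also have "\<dots> = M ^ card (insert a S) * card (?C (Suc u))"
        using insert.hyps unfolding M by simp
      finally show ?case .
    qed
  qed simp
  then show ?thesis by (simp add: M_def)
qed

text \<open>A substitute for Jensen's inequality: if the mean of \<open>x ^ s\<close> is at most \<open>M ^ p\<close>, then that
  of \<open>q ^ s\<close> is at most \<open>2 * y ^ p\<close>, with \<open>y\<close> as close to 1 as desired.\<close>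

lemma exists_interpolating_base:
  fixes M x y z :: real
  assumes "1 \<le> M" "1 < x" "1 < y" "1 < z"
  shows "\<exists>q. 1 < q \<and> q \<le> z \<and> (\<forall>p s. q ^ s \<le> y ^ p * (1 + x ^ s / M ^ p))"
proof -
  obtain N where N: "M < y ^ N" using real_arch_pow[OF assms(3)] by blast
  then have N0: "0 < N" using assms by (cases N) auto
  \<comment> \<open>With \<open>q ^ N \<le> x\<close> and \<open>M < y ^ N\<close>, the claim can be
    checked after raising both sides to the power \<open>N\<close>; the cap \<open>z\<close> only
    makes \<open>q\<close> smaller.\<close>
  define q where "q = min (root N x) z"
  have q: "1 < q" "q \<le> z" using assms N0 by (auto simp: q_def)
  have "q ^ N \<le> root N x ^ N" using q assms by (intro power_mono) (auto simp: q_def)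
  then have qN: "q ^ N \<le> x" using N0 assms by simp
  have "q ^ s \<le> y ^ p * (1 + x ^ s / M ^ p)" for p s
  proof -
    define Z where "Z = 1 + x ^ s / M ^ p"
    have Z: "1 \<le> Z" "x ^ s / M ^ p \<le> Z" using assms by (auto simp: Z_def)
    have "(q ^ s) ^ N = (q ^ N) ^ s" by (simp add: power_mult[symmetric] mult.commute)
    also have "\<dots> \<le> x ^ s" using qN q by (intro power_mono) auto
    also have "\<dots> \<le> M ^ p * Z" using Z(2) assms by (simp add: field_simps)
    also have "\<dots> \<le> (y ^ N) ^ p * Z ^ N"
      using N assms Z N0 by (intro mult_mono power_mono self_le_power) auto
    also have "\<dots> = (y ^ p * Z) ^ N" by (simp add: power_mult_distrib power_mult[symmetric] mult.commute)
    finally have "(q ^ s) ^ N \<le> (y ^ p * Z) ^ N" .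
    then show ?thesis
      using N0 assms Z unfolding Z_def[symmetric]
      by (subst (asm) power_mono_iff) (use q in auto)
  qed
  with q show ?thesis by blast
qed

text \<open>For each core vertex, the path to its nearest core leaf is fixed and the exponential
  moment of the chains on it is bounded. This gives a constant times \<open>(3/2) ^ k\<close> on
  average, where \<open>k\<close> is the protection number in the core, and
  \<open>branching_sum_root_protection\<close> sums these bounds.\<close>

lemma expand_expected_protection_bound:
  fixes r :: real
  assumes r: "0 \<le> r" "r < 1"
  obtains q C :: real where "1 < q" "0 < C"
    "\<And>T s u. branching T \<Longrightarrow> card (vertices T) = Suc s \<Longrightarrow> real u \<le> r * real (u + s) \<Longrightarrow>
      (\<Sum>l\<in>compositions (vertices T) u.
         \<Sum>v\<in>vertices (expand T l). q ^ root_protection (fringe (expand T l) v))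
      \<le> C * Suc s * card (compositions (vertices T) u)"
proof -
  \<comment> \<open>Any \<open>x > 1\<close> with \<open>x * r < 1\<close> would do.\<close>
  define x where "x = 2 / (1 + r)"
  have x: "1 < x" "x * r < 1" using r by (auto simp: x_def field_simps)
  define M where "M = 1 / (1 - x * r)"
  have M: "1 \<le> M" using x r by (simp add: M_def field_simps)
  \<comment> \<open>Each core edge of the path costs at most \<open>6/5\<close> and each chain
    \<open>5/4\<close>; their product is the base \<open>3/2\<close> that the core can
    afford.\<close>
  obtain q where q: "1 < q" "q \<le> 6/5" "\<And>p s. q ^ s \<le> (5/4) ^ p * (1 + x ^ s / M ^ p)"
    using exists_interpolating_base[OF M x(1), of "5/4" "6/5"] by auto
  let ?c = "q / (q - 1)"
  show thesis
  proof (rule that[of q "10 * ?c"])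
    fix T s u
    assume T: "branching T" "card (vertices T) = Suc s" and u: "real u \<le> r * real (u + s)"
    let ?F = "compositions (vertices T) u" and ?p = root_protection
    have pointwise: "(\<Sum>l\<in>?F. q ^ ?p (expand (fringe T v) (\<lambda>z. l (v @ z))))
        \<le> 5/2 * card ?F * (3/2) ^ ?p (fringe T v)" if v: "v \<in> vertices T" for v
    proof -
      let ?k = "?p (fringe T v)"
      obtain P where P: "P \<subseteq> vertices (fringe T v)" "card P = Suc ?k"
        "\<And>l. ?p (expand (fringe T v) l) \<le> ?k + sum l P"
        using expand_root_protection_path by blast
      let ?Q = "(@) v ` P"
      have Q: "?Q \<subseteq> vertices T" using P(1) v by (auto simp: append_in_vertices_iff)
      have cQ: "card ?Q = Suc ?k" using P(2) by (simp add: card_image inj_on_def)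
      have "q ^ ?p (expand (fringe T v) (\<lambda>z. l (v @ z)))
          \<le> (6/5) ^ ?k * ((5/4) ^ Suc ?k * (1 + x ^ sum l ?Q / M ^ Suc ?k))" for l
      proof -
        have "sum l ?Q = (\<Sum>z\<in>P. l (v @ z))" by (simp add: sum.reindex inj_on_def)
        then have "q ^ ?p (expand (fringe T v) (\<lambda>z. l (v @ z))) \<le> q ^ (?k + sum l ?Q)"
          using P(3)[of "\<lambda>z. l (v @ z)"] q by (intro power_increasing) auto
        also have "\<dots> = q ^ ?k * q ^ sum l ?Q" by (rule power_add)
        also have "\<dots> \<le> (6/5) ^ ?k * ((5/4) ^ Suc ?k * (1 + x ^ sum l ?Q / M ^ Suc ?k))"
          using q by (intro mult_mono power_mono q(3)) auto
        finally show ?thesis .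
      qed
      then have "(\<Sum>l\<in>?F. q ^ ?p (expand (fringe T v) (\<lambda>z. l (v @ z))))
          \<le> (\<Sum>l\<in>?F. (6/5) ^ ?k * ((5/4) ^ Suc ?k * (1 + x ^ sum l ?Q / M ^ Suc ?k)))"
        by (rule sum_mono)
      also have "\<dots> = (6/5) ^ ?k * (5/4) ^ Suc ?k * (card ?F + (\<Sum>l\<in>?F. x ^ sum l ?Q) / M ^ Suc ?k)"
        by (simp add: sum_distrib_left[symmetric] sum.distrib sum_divide_distrib[symmetric] del: power_Suc)
      also have "\<dots> \<le> (6/5) ^ ?k * (5/4) ^ Suc ?k * (card ?F + card ?F)"
      proof -
        have "(\<Sum>l\<in>?F. x ^ sum l ?Q) \<le> M ^ Suc ?k * card ?F"
          using compositions_exponential_moment[OF finite_vertices T(2) _ r(1) x(2) Q u] x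
          by (simp add: cQ M_def)
        then have "(\<Sum>l\<in>?F. x ^ sum l ?Q) / M ^ Suc ?k \<le> card ?F"
          using M by (simp add: divide_le_eq mult.commute del: power_Suc)
        then show ?thesis by (intro mult_left_mono add_left_mono) auto
      qed
      also have "\<dots> = 5/2 * card ?F * (6/5 * (5/4)) ^ ?k"
        by (simp add: power_mult_distrib del: times_divide_eq_right times_divide_eq_left)
      finally show ?thesis by simp
    qed
    have "(\<Sum>l\<in>?F. \<Sum>v\<in>vertices (expand T l). q ^ ?p (fringe (expand T l) v))
        \<le> (\<Sum>l\<in>?F. ?c * (\<Sum>v\<in>vertices T. q ^ ?p (expand (fringe T v) (\<lambda>z. l (v @ z)))))"
      by (intro sum_mono sum_root_protection_expand q)
    \<comment> \<open>Exchanging the sums fixes the core vertex, hence its path, before the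
      labellings are averaged.\<close>
    also have "\<dots> = ?c * (\<Sum>v\<in>vertices T. \<Sum>l\<in>?F. q ^ ?p (expand (fringe T v) (\<lambda>z. l (v @ z))))"
      unfolding sum_distrib_left[symmetric] by (subst sum.swap) simp
    also have "\<dots> \<le> ?c * (\<Sum>v\<in>vertices T. 5/2 * card ?F * (3/2) ^ ?p (fringe T v))"
      using q by (intro mult_left_mono sum_mono pointwise) auto
    also have "\<dots> = ?c * (5/2 * card ?F * (\<Sum>v\<in>vertices T. (3/2) ^ ?p (fringe T v)))"
      by (simp only: sum_distrib_left)
    also have "\<dots> \<le> ?c * (5/2 * card ?F * (4 * real (Suc s)))"
    proof (intro mult_left_mono)
      have "(0::real) \<le> 3 * (3/2) ^ ?p T" by simp
      then show "(\<Sum>v\<in>vertices T. (3/2 :: real) ^ ?p (fringe T v)) \<le> 4 * real (Suc s)"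
        using branching_sum_root_protection[OF T(1)] unfolding T(2) of_nat_mult of_nat_numeral
        by linarith
    qed (use q in auto)
    also have "c * (5/2 * f * (4 * m)) = 10 * c * m * f" for c f m :: real
      by simp
    finally show "(\<Sum>l\<in>?F. \<Sum>v\<in>vertices (expand T l). q ^ ?p (fringe (expand T l) v))
        \<le> 10 * ?c * Suc s * card ?F" .
  qed (use q in auto)
qed

section \<open>Small cores are unlikely\<close>

text \<open>For \<open>d \<ge> 1\<close> this adds \<open>d\<close> vertices: one of outdegree
  \<open>d\<close> and \<open>d - 1\<close> leaves. The old tree remains as the first subtree, which
  makes the operation injective.\<close>

definition graft :: "nat \<Rightarrow> plane_tree \<Rightarrow> plane_tree" where
  "graft d T = Node (T # replicate (d - 1) (Node []))"

lemma graft_inject [simp]: "graft d T = graft d S \<longleftrightarrow> T = S"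
  by (simp add: graft_def)

lemma branching_graft: "2 \<le> d \<Longrightarrow> branching T \<Longrightarrow> branching (graft d T)"
  by (auto simp: graft_def branching_Node nth_Cons split: nat.splits)

lemma card_vertices_graft: "1 \<le> d \<Longrightarrow> card (vertices (graft d T)) = card (vertices T) + d"
  by (cases d) (auto simp: graft_def card_vertices_Node sum.lessThan_Suc_shift simp del: sum.lessThan_Suc)

lemma tree_weight_graft: "1 \<le> d \<Longrightarrow> tree_weight w (graft d T) = w d * w 0 ^ (d - 1) * tree_weight w T"
  by (cases d) (auto simp: graft_def tree_weight_Node prod.lessThan_Suc_shift simp del: prod.lessThan_Suc)

text \<open>Raising the lower index from \<open>t\<close> to \<open>t + 1\<close> multiplies the
  binomial coefficient by \<open>(N - t) / (t + 1)\<close>, which is at least \<open>K\<close> as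
  long as \<open>(K + 1) * (t + 1) \<le> N\<close>.\<close>

lemma binomial_growth:
  "(K + 1) * (s + j) \<le> N \<Longrightarrow> K ^ j * (N choose s) \<le> N choose (s + j)"
proof (induction j)
  case (Suc j)
  let ?t = "s + j"
  have t: "?t < N" using Suc.prems by simp
  have "K * Suc ?t \<le> N - ?t"
    using Suc.prems by simp
  then have "K * (N choose ?t) * Suc ?t \<le> (N choose ?t) * (N - ?t)"
    using mult_le_mono2[of "K * Suc ?t" "N - ?t" "N choose ?t"] by (simp only: ac_simps)
  also have "\<dots> = (N choose Suc ?t) * Suc ?t"
    using Suc_times_binomial_add[of ?t "N - Suc ?t"] t by (simp add: mult.commute Suc_diff_Suc)
  finally have "K * (N choose ?t) \<le> N choose Suc ?t"
    by (subst (asm) mult_le_cancel2) auto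
  moreover have "K ^ j * (N choose s) \<le> N choose ?t" using Suc by simp
  then have "K ^ Suc j * (N choose s) \<le> K * (N choose ?t)"
    unfolding power_Suc mult.assoc by (rule mult_le_mono2)
  ultimately show ?case unfolding add_Suc_right by (rule order_trans[rotated])
qed simp

section \<open>The total weight decomposed by cores\<close>

definition cores :: "nat \<Rightarrow> plane_tree set" where
  "cores n = {T. branching T \<and> card (vertices T) \<le> n}"

lemma finite_cores: "finite (cores n)"
proof (rule finite_subset)
  show "cores n \<subseteq> (\<Union>m\<le>n. trees_of_size m)"
    by (auto simp: cores_def trees_of_size_def)
qed (auto simp: finite_trees_of_size)

lemma card_vertices_pos: "0 < card (vertices T)"
  by (simp add: card_gt_0_iff finite_vertices vertices_nonempty)

lemma bij_betw_expand:
  "bij_betw (\<lambda>(T, l). expand T l)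
    (SIGMA T:cores n. compositions (vertices T) (n - card (vertices T))) (trees_of_size n)"
  unfolding bij_betw_def
proof
  show "inj_on (\<lambda>(T, l). expand T l)
    (SIGMA T:cores n. compositions (vertices T) (n - card (vertices T)))"
    using expand_inject unfolding inj_on_def cores_def compositions_def by clarsimp
  show "(\<lambda>(T, l). expand T l) ` (SIGMA T:cores n. compositions (vertices T) (n - card (vertices T)))
      = trees_of_size n"
  proof (intro equalityI subsetI)
    fix S assume S: "S \<in> trees_of_size n"
    obtain T l where T: "branching T" "\<forall>v. v \<notin> vertices T \<longrightarrow> l v = 0" "S = expand T l"
      using expand_surj by metis
    with S have "n = card (vertices T) + sum l (vertices T)"
      by (simp add: trees_of_size_def card_vertices_expand)
    with T show "S \<in> (\<lambda>(T, l). expand T l) `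
        (SIGMA T:cores n. compositions (vertices T) (n - card (vertices T)))"
      by (intro image_eqI[of _ _ "(T, l)"]) (auto simp: cores_def compositions_def)
  qed (auto simp: trees_of_size_def card_vertices_expand cores_def compositions_def)
qed

lemma sum_trees_of_size:
  fixes f :: "plane_tree \<Rightarrow> real"
  shows "(\<Sum>T\<in>trees_of_size n. f T)
    = (\<Sum>T\<in>cores n. \<Sum>l\<in>compositions (vertices T) (n - card (vertices T)). f (expand T l))"
proof -
  have "(\<Sum>T\<in>trees_of_size n. f T)
      = (\<Sum>(T, l)\<in>(SIGMA T:cores n. compositions (vertices T) (n - card (vertices T))). f (expand T l))"
    using sum.reindex_bij_betw[OF bij_betw_expand, of f n] by (simp add: case_prod_unfold)
  also have "\<dots> = (\<Sum>T\<in>cores n. \<Sum>l\<in>compositions (vertices T) (n - card (vertices T)). f (expand T l))"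
    by (intro sum.Sigma[symmetric]) (auto simp: finite_cores finite_compositions finite_vertices)
  finally show ?thesis .
qed

text \<open>The total weight of the trees of size \<open>n\<close> with core \<open>T\<close>.\<close>

definition core_mass :: "(nat \<Rightarrow> real) \<Rightarrow> nat \<Rightarrow> plane_tree \<Rightarrow> real" where
  "core_mass w n T = tree_weight w T * w 1 ^ (n - card (vertices T)) *
     real (card (compositions (vertices T) (n - card (vertices T))))"

lemma card_compositions_vertices:
  assumes "card (vertices T) \<le> n"
  shows "card (compositions (vertices T) (n - card (vertices T)))
    = (n - 1) choose (card (vertices T) - 1)"
  using card_compositions[OF finite_vertices, of T "card (vertices T) - 1" "n - card (vertices T)"]
    card_vertices_pos[of T] assms by simp

lemma core_mass_nonneg: "weight_sequence w \<Longrightarrow> 0 \<le> core_mass w n T"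
  by (auto simp: core_mass_def weight_sequence_def tree_weight_nonneg intro!: mult_nonneg_nonneg)

lemma sum_core_mass: "(\<Sum>T\<in>cores n. core_mass w n T) = (\<Sum>T\<in>trees_of_size n. tree_weight w T)"
  unfolding sum_trees_of_size
proof (intro sum.cong refl)
  fix T
  show "core_mass w n T
      = (\<Sum>l\<in>compositions (vertices T) (n - card (vertices T)). tree_weight w (expand T l))"
    by (subst sum.cong[OF refl, of _ _ "\<lambda>_. w 1 ^ (n - card (vertices T)) * tree_weight w T"])
      (auto simp: core_mass_def tree_weight_expand compositions_def)
qed

text \<open>The gain comes from the binomial coefficient: while the core is small, each of its \<open>d\<close> new
  vertices multiplies the number of compositions by at least \<open>K\<close>, which outweighs the change
  of weight. As \<open>graft d\<close> is injective, iterating it shows that small cores have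
  exponentially small total mass.\<close>

lemma core_mass_graft:
  assumes w: "weight_sequence w" and d: "2 \<le> d"
    and K: "2 * w 1 ^ d \<le> w d * w 0 ^ (d - 1) * real K ^ d"
    and size: "(K + 1) * (card (vertices T) - 1 + d) \<le> n - 1"
  shows "2 * core_mass w n T \<le> core_mass w n (graft d T)"
proof -
  let ?m = "card (vertices T)"
  let ?b = "w d * w 0 ^ (d - 1)"
  have "?m - 1 + d \<le> (K + 1) * (?m - 1 + d)" by simp
  then have m: "?m + d \<le> n" using size d card_vertices_pos[of T] by linarith
  have cg: "card (vertices (graft d T)) = ?m + d" using d by (simp add: card_vertices_graft)
  have w0: "0 \<le> w k" for k using w by (simp add: weight_sequence_def)
  have bin: "real K ^ d * real ((n - 1) choose (?m - 1)) \<le> real ((n - 1) choose (?m + d - 1))"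
    using binomial_growth[OF size] card_vertices_pos[of T]
    by (metis Nat.add_diff_assoc2 Suc_leI One_nat_def of_nat_le_iff of_nat_mult of_nat_power)
  \<comment> \<open>At fixed size \<open>n\<close>, the \<open>d\<close> new core vertices replace
    \<open>d\<close> unary ones, so a factor \<open>w 1 ^ d\<close> is exchanged for
    \<open>?b\<close>.\<close>
  have "2 * core_mass w n T
      = (2 * w 1 ^ d) * (tree_weight w T * w 1 ^ (n - (?m + d)) * real ((n - 1) choose (?m - 1)))"
    using m by (simp add: core_mass_def card_compositions_vertices power_add[symmetric])
  also have "\<dots> \<le> (?b * real K ^ d) * (tree_weight w T * w 1 ^ (n - (?m + d)) * real ((n - 1) choose (?m - 1)))"
    using w0 w by (intro mult_right_mono K) (auto simp: tree_weight_nonneg)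
  also have "\<dots> = ?b * tree_weight w T * w 1 ^ (n - (?m + d)) * (real K ^ d * real ((n - 1) choose (?m - 1)))"
    by (simp only: ac_simps)
  also have "\<dots> \<le> ?b * tree_weight w T * w 1 ^ (n - (?m + d)) * real ((n - 1) choose (?m + d - 1))"
    using w0 w by (intro mult_left_mono bin) (auto simp: tree_weight_nonneg)
  also have "\<dots> = core_mass w n (graft d T)"
    using m d card_compositions_vertices[of "graft d T" n]
    by (simp add: core_mass_def cg tree_weight_graft)
  finally show ?thesis .
qed

lemma core_mass_graft_iterate:
  assumes w: "weight_sequence w" and d: "2 \<le> d"
    and K: "2 * w 1 ^ d \<le> w d * w 0 ^ (d - 1) * real K ^ d"
    and T: "T \<in> cores n"
  shows "(K + 1) * (card (vertices T) - 1 + j * d) \<le> n - 1 \<Longrightarrow>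
    2 ^ j * core_mass w n T \<le> core_mass w n ((graft d ^^ j) T) \<and> (graft d ^^ j) T \<in> cores n \<and>
    card (vertices ((graft d ^^ j) T)) = card (vertices T) + j * d"
proof (induction j)
  case 0
  show ?case using T by simp
next
  case (Suc j)
  let ?T = "(graft d ^^ j) T"
  have "(K + 1) * (card (vertices T) - 1 + j * d) \<le> (K + 1) * (card (vertices T) - 1 + Suc j * d)"
    by (intro mult_le_mono2) simp
  with Suc have IH: "2 ^ j * core_mass w n T \<le> core_mass w n ?T" "?T \<in> cores n"
    "card (vertices ?T) = card (vertices T) + j * d"
    by auto
  have eq: "card (vertices ?T) - 1 + d = card (vertices T) - 1 + Suc j * d"
    using IH(3) card_vertices_pos[of T] by simp
  have size: "(K + 1) * (card (vertices ?T) - 1 + d) \<le> n - 1"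
    unfolding eq by (rule Suc.prems)
  have "card (vertices ?T) - 1 + d \<le> (K + 1) * (card (vertices ?T) - 1 + d)" by simp
  then have "card (vertices ?T) + d \<le> n" using size d card_vertices_pos[of ?T] by linarith
  then have "graft d ?T \<in> cores n"
    using IH(2) d by (simp add: cores_def branching_graft card_vertices_graft)
  moreover have "2 ^ Suc j * core_mass w n T \<le> core_mass w n (graft d ?T)"
    using core_mass_graft[OF w d K size] IH(1) by simp
  moreover have "card (vertices (graft d ?T)) = card (vertices T) + Suc j * d"
    using IH(3) d by (simp add: card_vertices_graft)
  ultimately show ?case by simp
qed

text \<open>Grafting may continue while the core stays within a budget of size. A small core uses up
  less than half of it, which leaves the other half for the stated number of grafts. These map the
  small cores injectively into \<open>cores n\<close>, so their doubled masses add up to at most the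
  total weight.\<close>

lemma core_mass_small_cores:
  assumes w: "weight_sequence w" and d: "2 \<le> d"
    and K: "2 * w 1 ^ d \<le> w d * w 0 ^ (d - 1) * real K ^ d"
  shows "2 ^ ((n - 1) div (2 * (K + 1) * d)) *
      (\<Sum>T\<in>{T \<in> cores n. 2 * (K + 1) * (card (vertices T) - 1) < n - 1}. core_mass w n T)
    \<le> (\<Sum>T\<in>trees_of_size n. tree_weight w T)"
proof -
  let ?j = "(n - 1) div (2 * (K + 1) * d)"
  let ?B = "{T \<in> cores n. 2 * (K + 1) * (card (vertices T) - 1) < n - 1}"
  let ?g = "graft d ^^ ?j"
  have inj: "inj_on ?g ?B"
    by (intro inj_on_subset[OF inj_fn]) (auto simp: inj_on_def)
  have g: "2 ^ ?j * core_mass w n T \<le> core_mass w n (?g T) \<and> ?g T \<in> cores n" if T: "T \<in> ?B" for T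
  proof -
    have "2 * ((K + 1) * (?j * d)) \<le> n - 1"
      using div_times_less_eq_dividend[of "n - 1" "2 * (K + 1) * d"] by (simp only: ac_simps)
    then have "(K + 1) * (card (vertices T) - 1 + ?j * d) \<le> n - 1"
      using T unfolding distrib_left[of "K + 1"] by simp
    then show ?thesis using core_mass_graft_iterate[OF w d K, of T n ?j] T by blast
  qed
  have "2 ^ ?j * (\<Sum>T\<in>?B. core_mass w n T) \<le> (\<Sum>T\<in>?B. core_mass w n (?g T))"
    unfolding sum_distrib_left using g by (intro sum_mono) blast
  also have "\<dots> = (\<Sum>T\<in>?g ` ?B. core_mass w n T)"
    using inj by (simp add: sum.reindex)
  also have "\<dots> \<le> (\<Sum>T\<in>cores n. core_mass w n T)"
    using g w by (intro sum_mono2) (auto simp: finite_cores core_mass_nonneg)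
  finally show ?thesis unfolding sum_core_mass .
qed

lemma exists_growth_constant:
  assumes "weight_sequence w"
  obtains d K where "2 \<le> d" "2 * w 1 ^ d \<le> w d * w 0 ^ (d - 1) * real K ^ d"
proof -
  obtain d where d: "2 \<le> d" "0 < w d" and w: "0 < w 0"
    using assms by (auto simp: weight_sequence_def)
  let ?b = "w d * w 0 ^ (d - 1)"
  have b: "0 < ?b" using d w by simp
  obtain K :: nat where K: "2 * w 1 ^ d / ?b < K" using reals_Archimedean2 by blast
  \<comment> \<open>The successor ensures a base of at least 1, so that taking the power
    \<open>d\<close> does not decrease it.\<close>
  have "2 * w 1 ^ d / ?b \<le> real (Suc K)" using K by simp
  also have "\<dots> \<le> real (Suc K) ^ d" using d by (intro self_le_power) auto
  finally have "2 * w 1 ^ d \<le> ?b * real (Suc K) ^ d"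
    using b by (simp add: divide_le_eq mult.commute)
  with d show thesis by (intro that)
qed

section \<open>Exponential tails\<close>

definition protected_count :: "nat \<Rightarrow> plane_tree \<Rightarrow> nat" where
  "protected_count k T = card {v \<in> vertices T. k \<le> root_protection (fringe T v)}"

text \<open>A protection number is less than the size of the tree. For trees of size
  \<open>n\<close> only \<open>k < n\<close> matters, which turns exponential smallness in
  \<open>n\<close> into exponential smallness in \<open>k\<close>.\<close>

lemma protected_count_le:
  "protected_count k T \<le> (if k < card (vertices T) then card (vertices T) else 0)"
proof (cases "k < card (vertices T)")
  case True
  then show ?thesis by (auto simp: protected_count_def finite_vertices intro: card_mono)
next
  case False
  have "\<not> k \<le> root_protection (fringe T v)" if "v \<in> vertices T" for v
    using root_protection_fringe_less[OF that] False by linarith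
  then have "{v \<in> vertices T. k \<le> root_protection (fringe T v)} = {}" by blast
  then have "protected_count k T = 0" by (simp only: protected_count_def card.empty)
  then show ?thesis by simp
qed

lemma protected_count_markov:
  fixes q :: real
  assumes "1 < q"
  shows "q ^ k * protected_count k T \<le> (\<Sum>v\<in>vertices T. q ^ root_protection (fringe T v))"
proof -
  let ?A = "{v \<in> vertices T. k \<le> root_protection (fringe T v)}"
  have "q ^ k * protected_count k T = (\<Sum>v\<in>?A. q ^ k)"
    by (simp add: protected_count_def)
  also have "\<dots> \<le> (\<Sum>v\<in>?A. q ^ root_protection (fringe T v))"
    using assms by (intro sum_mono power_increasing) auto
  also have "\<dots> \<le> (\<Sum>v\<in>vertices T. q ^ root_protection (fringe T v))"
    using assms by (intro sum_mono2) (auto simp: finite_vertices)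
  finally show ?thesis .
qed

text \<open>Large cores are treated by Markov's inequality and the exponential moment, which gives
  \<open>C / q ^ k\<close>. Small cores are treated by the trivial count and their small total mass,
  which gives the other term.\<close>

lemma weighted_protected_count_bound:
  assumes w: "weight_sequence w"
  obtains q C :: real and D :: nat where "1 < q" "0 < C" "0 < D"
    "\<And>n k. (\<Sum>T\<in>trees_of_size n. tree_weight w T * protected_count k T)
      \<le> n * (C / q ^ k + 1 / 2 ^ (k div D)) * (\<Sum>T\<in>trees_of_size n. tree_weight w T)"
proof -
  obtain d K where d: "2 \<le> d" and K: "2 * w 1 ^ d \<le> w d * w 0 ^ (d - 1) * real K ^ d"
    using exists_growth_constant[OF w] by blast
  \<comment> \<open>A core outside \<open>?B\<close> with \<open>s + 1\<close> vertices has
    \<open>s \<ge> (n - 1) / (2 * (K + 1))\<close>; its \<open>n - 1 - s\<close> unary vertices are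
    then at most \<open>r * (n - 1)\<close>.\<close>
  define r where "r = 1 - 1 / real (2 * (K + 1))"
  have r: "0 \<le> r" "r < 1" by (auto simp: r_def field_simps)
  obtain q C :: real where q: "1 < q" "0 < C" and
    bound: "\<And>T s u. branching T \<Longrightarrow> card (vertices T) = Suc s \<Longrightarrow> real u \<le> r * real (u + s) \<Longrightarrow>
      (\<Sum>l\<in>compositions (vertices T) u.
         \<Sum>v\<in>vertices (expand T l). q ^ root_protection (fringe (expand T l) v))
      \<le> C * Suc s * card (compositions (vertices T) u)"
    by (fact expand_expected_protection_bound[OF r])
  let ?D = "2 * (K + 1) * d"
  show thesis
  proof (rule that[OF q])
    show "0 < ?D" using d by simp
    fix n k
    let ?Z = "\<Sum>T\<in>trees_of_size n. tree_weight w T"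
    let ?B = "{T \<in> cores n. 2 * (K + 1) * (card (vertices T) - 1) < n - 1}"
    let ?F = "\<lambda>T. compositions (vertices T) (n - card (vertices T))"
    let ?S = "\<lambda>T. \<Sum>l\<in>?F T. tree_weight w (expand T l) * protected_count k (expand T l)"
    have wnn: "0 \<le> w k" for k using w by (simp add: weight_sequence_def)
    have Z: "0 \<le> ?Z" using w by (simp add: sum_nonneg tree_weight_nonneg)
    have S: "?S T = tree_weight w T * w 1 ^ (n - card (vertices T)) * (\<Sum>l\<in>?F T. real (protected_count k (expand T l)))" for T
      unfolding sum_distrib_left
      by (intro sum.cong) (auto simp: tree_weight_expand compositions_def)
    have coef: "0 \<le> tree_weight w T * w 1 ^ (n - card (vertices T))" for T
      using w wnn by (simp add: tree_weight_nonneg)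
    have large: "?S T \<le> n * (C / q ^ k) * core_mass w n T" if T: "T \<in> cores n - ?B" for T
    proof -
      let ?m = "card (vertices T)"
      obtain s where s: "?m = Suc s" using card_vertices_pos[of T] gr0_conv_Suc by blast
      have m: "branching T" "?m \<le> n" "n - 1 \<le> 2 * (K + 1) * s" using T s by (auto simp: cores_def)
      have "real (n - 1) / real (2 * (K + 1)) \<le> s"
      proof -
        have "real (n - 1) \<le> s * real (2 * (K + 1))"
          unfolding of_nat_mult[symmetric] of_nat_le_iff using m(3) by (simp only: mult.commute)
        then show ?thesis by (subst pos_divide_le_eq) (simp_all del: of_nat_mult)
      qed
      moreover have N: "n - ?m + s = n - 1" using m(2) s by simp
      have "r * real (n - ?m + s) = real (n - 1) - real (n - 1) / real (2 * (K + 1))"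
        unfolding N r_def left_diff_distrib by simp
      ultimately have u: "real (n - ?m) \<le> r * real (n - ?m + s)"
        using N by linarith
      have "q ^ k * (\<Sum>l\<in>?F T. real (protected_count k (expand T l)))
          \<le> (\<Sum>l\<in>?F T. \<Sum>v\<in>vertices (expand T l). q ^ root_protection (fringe (expand T l) v))"
        unfolding sum_distrib_left by (intro sum_mono protected_count_markov q)
      also have "\<dots> \<le> C * Suc s * card (?F T)" by (rule bound[OF m(1) s u])
      also have "\<dots> \<le> C * n * card (?F T)"
        using m(2) s q by (intro mult_right_mono mult_left_mono) auto
      finally have "(\<Sum>l\<in>?F T. real (protected_count k (expand T l))) \<le> n * (C / q ^ k) * card (?F T)"
        using q by (simp add: pos_le_divide_eq mult.commute mult.left_commute)
      then have "?S T \<le> tree_weight w T * w 1 ^ (n - ?m) * (n * (C / q ^ k) * card (?F T))"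
        unfolding S by (intro mult_left_mono coef)
      also have "\<dots> = n * (C / q ^ k) * core_mass w n T" by (simp add: core_mass_def)
      finally show ?thesis .
    qed
    have small: "?S T \<le> (if k < n then real n else 0) * core_mass w n T" if T: "T \<in> ?B" for T
    proof -
      have "(\<Sum>l\<in>?F T. real (protected_count k (expand T l))) \<le> (\<Sum>l\<in>?F T. if k < n then real n else 0)"
      proof (intro sum_mono)
        fix l assume "l \<in> ?F T"
        then have "card (vertices (expand T l)) = n"
          using T by (simp add: card_vertices_expand compositions_def cores_def)
        then show "real (protected_count k (expand T l)) \<le> (if k < n then real n else 0)"
          using protected_count_le[of k "expand T l"] by (auto split: if_splits)
      qed
      then have "?S T \<le> tree_weight w T * w 1 ^ (n - card (vertices T)) * (\<Sum>l\<in>?F T. if k < n then real n else 0)"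
        unfolding S by (intro mult_left_mono coef)
      then show ?thesis by (cases "k < n") (simp_all add: core_mass_def mult.commute mult.left_commute)
    qed
    have "(\<Sum>T\<in>?B. ?S T) \<le> (\<Sum>T\<in>?B. (if k < n then real n else 0) * core_mass w n T)"
      by (intro sum_mono small)
    also have "\<dots> = (if k < n then real n else 0) * (\<Sum>T\<in>?B. core_mass w n T)"
      by (simp only: sum_distrib_left)
    also have "\<dots> \<le> n * (1 / 2 ^ (k div ?D)) * ?Z"
    proof (cases "k < n")
      case True
      \<comment> \<open>Here \<open>k < n\<close> is used in the form \<open>k \<le> n - 1\<close>,
        to compare the two exponents.\<close>
      have "(2::real) ^ (k div ?D) * (\<Sum>T\<in>?B. core_mass w n T)
          \<le> 2 ^ ((n - 1) div ?D) * (\<Sum>T\<in>?B. core_mass w n T)"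
        using True w by (intro mult_right_mono power_increasing div_le_mono sum_nonneg core_mass_nonneg) auto
      also have "\<dots> \<le> ?Z" by (rule core_mass_small_cores[OF w d K])
      finally have "(\<Sum>T\<in>?B. core_mass w n T) \<le> 1 / 2 ^ (k div ?D) * ?Z"
        by (simp add: field_simps)
      then have "n * (\<Sum>T\<in>?B. core_mass w n T) \<le> n * (1 / 2 ^ (k div ?D) * ?Z)"
        by (rule mult_left_mono) simp
      then show ?thesis using True by simp
    next
      case False
      then show ?thesis using Z by simp
    qed
    finally have B: "(\<Sum>T\<in>?B. ?S T) \<le> n * (1 / 2 ^ (k div ?D)) * ?Z" .
    have "(\<Sum>T\<in>cores n - ?B. ?S T) \<le> (\<Sum>T\<in>cores n - ?B. n * (C / q ^ k) * core_mass w n T)"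
      by (intro sum_mono large)
    also have "\<dots> \<le> (\<Sum>T\<in>cores n. n * (C / q ^ k) * core_mass w n T)"
      using q w by (intro sum_mono2) (auto simp: finite_cores core_mass_nonneg)
    also have "\<dots> = n * (C / q ^ k) * ?Z"
      by (simp only: sum_distrib_left[symmetric] sum_core_mass)
    finally have G: "(\<Sum>T\<in>cores n - ?B. ?S T) \<le> n * (C / q ^ k) * ?Z" .
    have "(\<Sum>T\<in>trees_of_size n. tree_weight w T * protected_count k T)
        = (\<Sum>T\<in>cores n - ?B. ?S T) + (\<Sum>T\<in>?B. ?S T)"
      unfolding sum_trees_of_size by (rule sum.subset_diff) (auto simp: finite_cores)
    also have "\<dots> \<le> n * (C / q ^ k + 1 / 2 ^ (k div ?D)) * ?Z"
      using B G by (simp only: distrib_left distrib_right)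
    finally show "(\<Sum>T\<in>trees_of_size n. tree_weight w T * protected_count k T)
      \<le> n * (C / q ^ k + 1 / 2 ^ (k div ?D)) * ?Z" .
  qed
qed

section \<open>The law of the marked tree and the final bounds\<close>

lemma marked_sgt_alt:
  "marked_sgt w n = bind_pmf (sgt w n) (\<lambda>T. map_pmf (Pair T) (pmf_of_set (vertices T)))"
  by (simp add: marked_sgt_def map_pmf_def)

lemma set_pmf_marked_sgt: "(T, v) \<in> set_pmf (marked_sgt w n) \<Longrightarrow> v \<in> vertices T"
  by (auto simp: marked_sgt_alt finite_vertices vertices_nonempty)

text \<open>Every tree in the support has exactly \<open>n\<close> vertices, so the conditional
  probability given the tree is a count divided by the constant \<open>n\<close>.\<close>

lemma prob_marked_sgt:
  assumes w: "weight_sequence w" "sgt_defined w n"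
  shows "measure_pmf.prob (marked_sgt w n) {(T, v). P T v} =
    (\<Sum>T\<in>trees_of_size n. tree_weight w T * card {v \<in> vertices T. P T v})
      / (n * (\<Sum>T\<in>trees_of_size n. tree_weight w T))"
proof -
  let ?Z = "\<Sum>T\<in>trees_of_size n. tree_weight w T"
  let ?f = "\<lambda>T. real (card {v \<in> vertices T. P T v}) / card (vertices T)"
  have sub: "set_pmf (sgt w n) \<subseteq> trees_of_size n"
    using pmf_sgt[OF w] by (auto simp: set_pmf_eq)
  have f: "emeasure (map_pmf (Pair T) (pmf_of_set (vertices T))) {(T, v). P T v} = ennreal (?f T)" for T
    by (simp add: emeasure_pmf_of_set finite_vertices vertices_nonempty vimage_def Int_def)
  have "emeasure (marked_sgt w n) {(T, v). P T v} = (\<integral>\<^sup>+T. ennreal (?f T) \<partial>sgt w n)"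
    unfolding marked_sgt_alt emeasure_bind_pmf by (simp only: f)
  also have "\<dots> = (\<Sum>T\<in>trees_of_size n. ennreal (?f T) * ennreal (pmf (sgt w n) T))"
    using sub by (intro nn_integral_measure_pmf_support) (auto simp: finite_trees_of_size set_pmf_eq)
  also have "\<dots> = ennreal (\<Sum>T\<in>trees_of_size n. ?f T * pmf (sgt w n) T)"
    by (simp add: ennreal_mult[symmetric])
  finally have "measure_pmf.prob (marked_sgt w n) {(T, v). P T v}
      = (\<Sum>T\<in>trees_of_size n. ?f T * pmf (sgt w n) T)"
    by (simp add: measure_pmf.emeasure_eq_measure sum_nonneg)
  also have "\<dots> = (\<Sum>T\<in>trees_of_size n. tree_weight w T * card {v \<in> vertices T. P T v} / (n * ?Z))"
    by (intro sum.cong) (auto simp: pmf_sgt[OF w] trees_of_size_def)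
  finally show ?thesis by (simp add: sum_divide_distrib)
qed

text \<open>The factor 2 pays for rounding \<open>k / D\<close> down.\<close>

lemma half_power_div_le:
  fixes D k :: nat
  assumes "0 < D"
  shows "1 / 2 ^ (k div D) \<le> (2 :: real) * exp (- (ln 2 / D) * k)"
proof -
  have "k < (k div D + 1) * D"
    using assms by (simp add: dividend_less_div_times)
  then have "real k \<le> real ((k div D + 1) * D)"
    by (simp only: of_nat_le_iff less_imp_le)
  then have "real k / D \<le> real (k div D + 1)"
    using assms by (simp only: pos_divide_le_eq of_nat_0_less_iff of_nat_mult)
  then have "ln 2 * (real k / D) \<le> ln 2 * real (k div D + 1)"
    by (intro mult_left_mono) auto
  then have "exp (ln 2 * (real k / D)) \<le> exp (ln 2 * real (k div D + 1))"
    by (simp only: exp_le_cancel_iff)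
  also have "\<dots> = 2 * 2 ^ (k div D)"
    using exp_of_nat_mult[of "k div D + 1" "ln (2::real)"] by (simp add: mult.commute)
  finally have "1 / 2 ^ (k div D) \<le> 2 * (1 / exp (ln 2 * (real k / D)))"
    by (simp add: field_simps)
  also have "1 / exp (ln 2 * (real k / D)) = exp (- (ln 2 / D) * k)"
    by (simp add: exp_minus inverse_eq_divide)
  finally show ?thesis .
qed

lemma exp_tail_protection_number:
  assumes w: "weight_sequence w"
  shows "\<exists>n\<^sub>0 C c. n\<^sub>0 \<ge> 1 \<and> C > 0 \<and> c > 0 \<and> exp_tail protection_number w n\<^sub>0 C c"
proof -
  obtain q C :: real and D :: nat where q: "1 < q" "0 < C" "0 < D" and bound:
    "\<And>n k. (\<Sum>T\<in>trees_of_size n. tree_weight w T * protected_count k T)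
      \<le> n * (C / q ^ k + 1 / 2 ^ (k div D)) * (\<Sum>T\<in>trees_of_size n. tree_weight w T)"
    by (fact weighted_protected_count_bound[OF w])
  \<comment> \<open>The slower of the two decay rates; in the constant \<open>C + 2\<close> below,
    the 2 comes from \<open>half_power_div_le\<close>.\<close>
  define c where "c = min (ln q) (ln 2 / D)"
  have c: "0 < c" "c \<le> ln q" "c \<le> ln 2 / D" using q by (auto simp: c_def)
  have "exp_tail protection_number w 1 (C + 2) c"
    unfolding exp_tail_def
  proof (intro allI impI)
    fix n k assume n: "1 \<le> n" "sgt_defined w n"
    let ?Z = "\<Sum>T\<in>trees_of_size n. tree_weight w T"
    have "0 < ?Z"
      using n(2) w finite_trees_of_size tree_weight_nonneg
      by (auto simp: sgt_defined_def intro: sum_pos2)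
    then have nZ: "0 < n * ?Z" using n by simp
    have "measure_pmf.prob (marked_sgt w n) {(T, v). k \<le> protection_number T v}
        = (\<Sum>T\<in>trees_of_size n. tree_weight w T * card {v \<in> vertices T. k \<le> protection_number T v}) / (n * ?Z)"
      by (rule prob_marked_sgt[OF w n(2)])
    also have "\<dots> \<le> (\<Sum>T\<in>trees_of_size n. tree_weight w T * protected_count k T) / (n * ?Z)"
    proof (intro divide_right_mono sum_mono mult_left_mono)
      fix T
      have "{v \<in> vertices T. k \<le> protection_number T v}
          \<subseteq> {v \<in> vertices T. k \<le> root_protection (fringe T v)}"
        using protection_number_le order_trans by blast
      then show "real (card {v \<in> vertices T. k \<le> protection_number T v}) \<le> protected_count k T"
        by (auto simp: protected_count_def finite_vertices intro: card_mono)
    qed (use nZ w in \<open>auto simp: tree_weight_nonneg\<close>)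
    also have "\<dots> \<le> C / q ^ k + 1 / 2 ^ (k div D)"
      using bound[where n=n and k=k] nZ by (subst divide_le_eq) (simp add: ac_simps)
    also have "\<dots> \<le> C * exp (- c * k) + 2 * exp (- c * k)"
    proof (rule add_mono)
      have "1 / q ^ k = exp (- ln q * k)"
        using q exp_of_nat_mult[of k "ln q"] by (simp add: exp_minus inverse_eq_divide mult.commute)
      also have "\<dots> \<le> exp (- c * k)" using c by (simp add: mult_right_mono)
      finally show "C / q ^ k \<le> C * exp (- c * k)"
        using q mult_left_mono[of "1 / q ^ k" "exp (- c * k)" C] by simp
      have "exp (- (ln 2 / D) * k) \<le> exp (- c * k)"
        using mult_right_mono[OF c(3), of "real k"] by simp
      then show "1 / 2 ^ (k div D) \<le> 2 * exp (- c * k)"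
        using half_power_div_le[OF q(3), of k] by linarith
    qed
    also have "\<dots> = (C + 2) * exp (- c * k)" by (simp add: distrib_right)
    finally show "measure_pmf.prob (marked_sgt w n) {(T, v). k \<le> protection_number T v}
      \<le> (C + 2) * exp (- c * real k)" .
  qed
  with q c show ?thesis by (intro exI[of _ 1] exI[of _ "C + 2"] exI[of _ c]) auto
qed

lemma exp_tail_leaf_dist:
  assumes "exp_tail protection_number w n\<^sub>0 C c"
  shows "exp_tail leaf_dist w n\<^sub>0 C c"
  unfolding exp_tail_def
proof (intro allI impI)
  fix n k assume n: "n\<^sub>0 \<le> n" "sgt_defined w n"
  have "measure_pmf.prob (marked_sgt w n) {(T, v). k \<le> leaf_dist T v}
      \<le> measure_pmf.prob (marked_sgt w n) {(T, v). k \<le> protection_number T v}"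
  \<comment> \<open>The pointwise comparison requires \<open>v\<close> to be a vertex of
    \<open>T\<close>, so the inclusion of events is shown almost surely only.\<close>
  proof (rule measure_pmf.finite_measure_mono_AE)
    show "AE p in marked_sgt w n. p \<in> {(T, v). k \<le> leaf_dist T v} \<longrightarrow> p \<in> {(T, v). k \<le> protection_number T v}"
      using leaf_dist_le_protection_number set_pmf_marked_sgt
      by (fastforce simp: AE_measure_pmf_iff intro: order_trans)
  qed simp
  also have "\<dots> \<le> C * exp (- c * real k)"
    using assms n by (simp add: exp_tail_def)
  finally show "measure_pmf.prob (marked_sgt w n) {(T, v). k \<le> leaf_dist T v} \<le> C * exp (- c * real k)" .
qed

theorem corollary6p3:
  fixes w :: "nat \<Rightarrow> real"
  assumes "weight_sequence w"
    and "type_I w \<or> type_II w \<or> type_III w"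
  shows "(\<exists>n\<^sub>0 C c. n\<^sub>0 \<ge> 1 \<and> C > 0 \<and> c > 0 \<and>
            exp_tail protection_number w n\<^sub>0 C c \<and> exp_tail leaf_dist w n\<^sub>0 C c) \<and>
         (\<forall>n\<^sub>0 C c. n\<^sub>0 \<ge> 1 \<and> C > 0 \<and> c > 0 \<and> exp_tail protection_number w n\<^sub>0 C c \<longrightarrow>
            exp_tail leaf_dist w n\<^sub>0 C c)"
  using exp_tail_protection_number[OF assms(1)] exp_tail_leaf_dist by blast

end
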